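(* For any (possibly cost-varying) principal-agent problem $(\mathbf c,\mathbf F,\mathbf r)$ with $n$ actions and $T$ types, let $S(\mathbf c)$ be the multiset of cost differences $\{c^{(t)}_{i+1}-c^{(t)}_i : i\in[n-1],\,t\in[T]\}$. Assume $S(\mathbf c)$ has $U$ distinct values, which appear with multiplicities $m_1,m_2,\dots,m_U$. Then $$\mathrm{OptLinear}(\mathbf c,\mathbf F,\mathbf r)\ \ge\ \Omega\left(\frac{1}{\Delta(\mathbf c)}\right)\mathrm{Welfare}(\mathbf c,\mathbf F,\mathbf r),\qquad\text{where } \Delta(\mathbf c)=\sum_{i=1}^U\log m_i.$$
   Context: A cost-varying typed principal-agent problem $(\mathbf c,\mathbf F,\mathbf r)$ with $n$ actions, $m$ outcomes and $T$ types consists of: for each type $t\in[T]$ a cost vector $\mathbf c^{(t)}\in\mathbb R_{\ge 0}^n$ with $0=c^{(t)}_1\le c^{(t)}_2\le\dots\le c^{(t)}_n$ ($\mathbf c$ denotes the collection of these vectors); rewards $\mathbf r\in\mathbb R_{\ge0}^m$ with $0=r_1\le\dots\le r_m$; and, for each type $t$ and action $i\in[n]$, a probability distribution $(F^{(t)}_{i,j})_{j\in[m]}$ over outcomes. If the cost vectors do not depend on $t$, the problem is not cost-varying. The agent's type is uniform on $[T]$; $\mathbb E_t$ denotes the expectation over it. Let $R^{(t)}_i=\sum_jF^{(t)}_{i,j}r_j$. A contract is a vector $\mathbf x\in\mathbb R_{\ge0}^m$. Under $\mathbf x$, an agent of type $t$ plays an action $i_*^{(t)}(\mathbf x)\in\arg\max_i\big(\sum_j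 F^{(t)}_{i,j}x_j-c^{(t)}_i\big)$, ties being broken so as to maximize the principal's profit $\mathrm{Profit}^{(t)}(\mathbf x)=\sum_j F^{(t)}_{i_*^{(t)}(\mathbf x),j}(r_j-x_j)$. $\mathrm{Welfare}=\mathbb E_t[\max_i(R^{(t)}_i-c^{(t)}_i)]$ and $\mathrm{OptLinear}=\max_{\alpha\in[0,1]}\mathbb E_t[\mathrm{Profit}^{(t)}(\alpha\mathbf r)]$ (best linear contract $\mathbf x=\alpha\mathbf r$). The constant hidden in $\Omega$ is absolute.
   Formalization: In Δ(c), each log m_i is replaced by max(1, log_2 m_i), so cost differences of multiplicity 1 contribute 1 instead of 0; with literal log m_i the bound is false (or undefined when Δ = 0). For a single action, where Δ = 0, the claim is read as OptLinear ≥ 0. *)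

theory Defs
  imports Complex_Main "HOL-Library.Multiset"
begin

text \<open>
  Actions, outcomes and types are indexed by \<open>{1..n}\<close>, \<open>{1..m}\<close> and \<open>{1..T}\<close>;
  \<open>c t i\<close> is the cost of action \<open>i\<close> for type \<open>t\<close>, \<open>F t i j\<close> the probability that action \<open>i\<close> of
  type \<open>t\<close> leads to outcome \<open>j\<close>, and \<open>r j\<close> the reward of outcome \<open>j\<close>. Values outside these
  index ranges are irrelevant.
\<close>

definition principal_agent ::
  "nat \<Rightarrow> nat \<Rightarrow> nat \<Rightarrow> (nat \<Rightarrow> nat \<Rightarrow> real) \<Rightarrow> (nat \<Rightarrow> nat \<Rightarrow> nat \<Rightarrow> real) \<Rightarrow> (nat \<Rightarrow> real) \<Rightarrow> bool"
  where
  "principal_agent n m T c F r \<longleftrightarrow>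
     1 \<le> n \<and> 1 \<le> m \<and> 1 \<le> T \<and>
     (\<forall>t\<in>{1..T}. c t 1 = 0 \<and> mono_on {1..n} (c t)) \<and>
     r 1 = 0 \<and> mono_on {1..m} r \<and>
     (\<forall>t\<in>{1..T}. \<forall>i\<in>{1..n}. (\<forall>j\<in>{1..m}. 0 \<le> F t i j) \<and> (\<Sum>j=1..m. F t i j) = 1)"

definition expected_reward ::
  "nat \<Rightarrow> (nat \<Rightarrow> nat \<Rightarrow> nat \<Rightarrow> real) \<Rightarrow> (nat \<Rightarrow> real) \<Rightarrow> nat \<Rightarrow> nat \<Rightarrow> real" where
  "expected_reward m F r t i = (\<Sum>j=1..m. F t i j * r j)"

definition best_responses ::
  "nat \<Rightarrow> nat \<Rightarrow> (nat \<Rightarrow> nat \<Rightarrow> real) \<Rightarrow> (nat \<Rightarrow> nat \<Rightarrow> nat \<Rightarrow> real) \<Rightarrow> nat \<Rightarrow> (nat \<Rightarrow> real) \<Rightarrow> nat set"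
  where
  "best_responses n m c F t x =
     {i. is_arg_max (\<lambda>i. (\<Sum>j=1..m. F t i j * x j) - c t i) (\<lambda>i. i \<in> {1..n}) i}"

text \<open>Among the best responses, one that is most profitable for the principal is played.\<close>

definition agent_action ::
  "nat \<Rightarrow> nat \<Rightarrow> (nat \<Rightarrow> nat \<Rightarrow> real) \<Rightarrow> (nat \<Rightarrow> nat \<Rightarrow> nat \<Rightarrow> real) \<Rightarrow> (nat \<Rightarrow> real) \<Rightarrow>
   nat \<Rightarrow> (nat \<Rightarrow> real) \<Rightarrow> nat" where
  "agent_action n m c F r t x =
     arg_max_on (\<lambda>i. \<Sum>j=1..m. F t i j * (r j - x j)) (best_responses n m c F t x)"

definition profit ::
  "nat \<Rightarrow> nat \<Rightarrow> (nat \<Rightarrow> nat \<Rightarrow> real) \<Rightarrow> (nat \<Rightarrow> nat \<Rightarrow> nat \<Rightarrow> real) \<Rightarrow> (nat \<Rightarrow> real) \<Rightarrow>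
   nat \<Rightarrow> (nat \<Rightarrow> real) \<Rightarrow> real" where
  "profit n m c F r t x =
     (\<Sum>j=1..m. F t (agent_action n m c F r t x) j * (r j - x j))"

definition type_avg :: "nat \<Rightarrow> (nat \<Rightarrow> real) \<Rightarrow> real" where
  "type_avg T f = (\<Sum>t=1..T. f t) / real T"

definition welfare ::
  "nat \<Rightarrow> nat \<Rightarrow> nat \<Rightarrow> (nat \<Rightarrow> nat \<Rightarrow> real) \<Rightarrow> (nat \<Rightarrow> nat \<Rightarrow> nat \<Rightarrow> real) \<Rightarrow> (nat \<Rightarrow> real) \<Rightarrow> real"
  where
  "welfare n m T c F r =
     type_avg T (\<lambda>t. Max ((\<lambda>i. expected_reward m F r t i - c t i) ` {1..n}))"

text \<open>
  The supremum is a maximum: with ties broken in favour of the principal, the expected profit of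
  \<open>\<alpha> \<cdot> r\<close> is nonincreasing in \<open>\<alpha>\<close> on each of finitely many left-closed intervals covering \<open>[0,1]\<close>.
\<close>

definition opt_linear ::
  "nat \<Rightarrow> nat \<Rightarrow> nat \<Rightarrow> (nat \<Rightarrow> nat \<Rightarrow> real) \<Rightarrow> (nat \<Rightarrow> nat \<Rightarrow> nat \<Rightarrow> real) \<Rightarrow> (nat \<Rightarrow> real) \<Rightarrow> real"
  where
  "opt_linear n m T c F r =
     (SUP \<alpha>\<in>{0..1}. type_avg T (\<lambda>t. profit n m c F r t (\<lambda>j. \<alpha> * r j)))"

definition cost_differences :: "nat \<Rightarrow> nat \<Rightarrow> (nat \<Rightarrow> nat \<Rightarrow> real) \<Rightarrow> real multiset" where
  "cost_differences n T c =
     image_mset (\<lambda>(t, i). c t (i + 1) - c t i) (mset_set ({1..T} \<times> {1..<n}))"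

text \<open>
  The sum of the logarithms of the multiplicities of the distinct cost differences. The logarithm
  is truncated below at \<open>1\<close>, as is usual inside asymptotic bounds: a value of multiplicity \<open>1\<close>
  contributes \<open>1\<close> and not \<open>0\<close>, whereas multiplicities \<open>\<ge> 2\<close> contribute exactly \<open>log 2\<close> of
  themselves. Without the truncation no absolute constant exists. For one type, expected rewards
  \<open>2 ^ i\<close> and costs \<open>2 ^ i - i - 1\<close> for \<open>i \<in> {1..K}\<close>, the cost differences are distinct, the
  welfare is \<open>K + 1\<close>, and every linear contract has profit at most \<open>2\<close>; this remains so when a
  further, useless action is added that repeats one cost difference and makes the untruncated
  sum equal to \<open>log 2 2\<close>.
\<close>

definition Delta :: "nat \<Rightarrow> nat \<Rightarrow> (nat \<Rightarrow> nat \<Rightarrow> real) \<Rightarrow> real" where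
  "Delta n T c =
     (\<Sum>d\<in>set_mset (cost_differences n T c).
        max 1 (log 2 (real (count (cost_differences n T c) d))))"

end

theory Submission
  imports Defs
begin

text \<open>
  As \<open>\<alpha>\<close> grows from \<open>0\<close> to \<open>1\<close>, the best response of a fixed type to \<open>\<alpha> \<cdot> r\<close> climbs through the
  costs. If the gap of size \<open>d\<close> between two consecutive costs is passed at \<open>\<alpha> = \<theta>\<close>, then passing it
  raises the expected reward by \<open>d / \<theta>\<close>, hence adds \<open>(1 - \<theta>) d / \<theta>\<close> to the welfare. So, up to the
  reward obtained at \<open>\<alpha> = 0\<close>, the welfare is a sum over all cost gaps, which is estimated separately
  for each value \<open>d\<close>. Let \<open>Q\<close> be \<open>T\<close> times the optimal profit. Then
  \<open>(1 - \<beta>) \<Sum>\<theta>\<le>\<beta>. d / \<theta> \<le> Q\<close> for every \<open>\<beta> < 1\<close>. Gaps with \<open>\<theta> \<le> 1/2\<close> contribute at most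
  \<open>2 Q\<close>, by \<open>\<beta> = 1/2\<close>. Among the others, the one with the \<open>k\<close>-th smallest \<open>\<theta>\<close> satisfies
  \<open>(1 - \<theta>) k d \<le> Q\<close>, so that the rest is bounded by a harmonic sum.
\<close>

subsection \<open>A harmonic bound\<close>

text \<open>The smallest value has rank \<open>card A\<close>, counted from the top, so it is at
  most \<open>Q / card A\<close>. Removing it and repeating bounds the sum by \<open>Q\<close> times
  a harmonic sum.\<close>

lemma sum_le_of_rank_bound:
  fixes b :: "'a \<Rightarrow> real"
  assumes "finite A" "A \<noteq> {}" "0 \<le> Q"
    and "\<And>x. x \<in> A \<Longrightarrow> b x * real (card {y \<in> A. b x \<le> b y}) \<le> Q"
  shows "sum b A \<le> Q * (1 + ln (real (card A)))"
  using assms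
proof (induction "card A" arbitrary: A)
  case 0
  then show ?case by simp
next
  case (Suc N)
  obtain x where x: "x \<in> A" "\<And>y. y \<in> A \<Longrightarrow> b x \<le> b y"
    using ex_is_arg_min_if_finite[OF Suc.prems(1,2), of b] by (auto simp: is_arg_min_linorder)
  have "{y \<in> A. b x \<le> b y} = A"
    using x by auto
  then have bx: "b x \<le> Q / real (Suc N)"
    using Suc.prems(4)[OF x(1)] Suc.hyps(2) by (simp add: field_simps)
  have cardB: "card (A - {x}) = N"
    using Suc.hyps(2) Suc.prems(1) x(1) by simp
  have split: "sum b A = b x + sum b (A - {x})"
    by (rule sum.remove) (use Suc.prems(1) x(1) in auto)
  show ?case
  proof (cases "N = 0")
    case True
    then have "A - {x} = {}"
      using cardB Suc.prems(1) by simp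
    then have "sum b (A - {x}) = 0"
      by (simp only: sum.empty)
    then show ?thesis
      using True split bx Suc.hyps(2)[symmetric] by simp
  next
    case False
    \<comment> \<open>Removing \<open>x\<close> can only lower ranks, which preserves the bound if
      \<open>b y\<close> is nonnegative. For negative \<open>b y\<close> the product is at most 0,
      hence at most \<open>Q\<close>.\<close>
    have rank: "b y * real (card {z \<in> A - {x}. b y \<le> b z}) \<le> Q" if y: "y \<in> A - {x}" for y
    proof (cases "0 \<le> b y")
      case True
      have "card {z \<in> A - {x}. b y \<le> b z} \<le> card {z \<in> A. b y \<le> b z}"
        by (rule card_mono) (use Suc.prems(1) in auto)
      then have "b y * real (card {z \<in> A - {x}. b y \<le> b z})
          \<le> b y * real (card {z \<in> A. b y \<le> b z})"
        using True by (intro mult_left_mono) auto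
      then show ?thesis
        using Suc.prems(4)[of y] y by auto
    next
      case False
      then show ?thesis
        using Suc.prems(3) by (meson mult_nonpos_nonneg nle_le of_nat_0_le_iff order_trans)
    qed
    have ne: "A - {x} \<noteq> {}"
      using cardB False by (metis card.empty)
    have "sum b (A - {x}) \<le> Q * (1 + ln (real (card (A - {x}))))"
      by (rule Suc.hyps(1)[OF cardB[symmetric] finite_Diff[OF Suc.prems(1)] ne Suc.prems(3) rank])
    then have IH: "sum b (A - {x}) \<le> Q * (1 + ln (real N))"
      using cardB by simp
    \<comment> \<open>Taking \<open>ln z \<le> z - 1\<close> at \<open>z = N / (N + 1)\<close>
      bounds the harmonic term \<open>1 / (N + 1)\<close> by
      \<open>ln (N + 1) - ln N\<close>.\<close>
    have "ln (real N / real (Suc N)) \<le> real N / real (Suc N) - 1"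
      by (rule ln_le_minus_one) (use False in simp)
    moreover have "real N / real (Suc N) - 1 = - 1 / real (Suc N)"
      by (simp add: field_simps)
    moreover have "ln (real N / real (Suc N)) = ln (real N) - ln (real (Suc N))"
      using False by (subst ln_div) simp_all
    ultimately have "1 / real (Suc N) \<le> ln (real (Suc N)) - ln (real N)"
      by simp
    then have "Q * (1 / real (Suc N)) \<le> Q * (ln (real (Suc N)) - ln (real N))"
      using Suc.prems(3) by (rule mult_left_mono)
    then show ?thesis
      using split IH bx Suc.hyps(2)[symmetric] by (simp add: algebra_simps)
  qed
qed

text \<open>The constant is 2 + 4: thresholds up to 1/2 cost \<open>2 * Q\<close>; above 1/2,
  replacing \<open>1 / \<theta>\<close> by 2 costs one factor 2, and replacing \<open>1 + ln\<close>
  by twice the truncated \<open>log 2\<close> another.\<close>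

lemma sum_gaps_le:
  fixes \<theta> :: "'a \<Rightarrow> real"
  assumes fin: "finite A" and A: "A \<noteq> {}" and Q: "0 \<le> Q" and d: "0 \<le> d"
    and \<theta>: "\<And>x. x \<in> A \<Longrightarrow> 0 < \<theta> x \<and> \<theta> x \<le> 1"
    and bound: "\<And>\<beta>. 0 \<le> \<beta> \<Longrightarrow> \<beta> < 1 \<Longrightarrow> (1 - \<beta>) * (\<Sum>x\<in>{x \<in> A. \<theta> x \<le> \<beta>}. d / \<theta> x) \<le> Q"
  shows "(\<Sum>x\<in>A. (1 - \<theta> x) * (d / \<theta> x)) \<le> 6 * Q * max 1 (log 2 (real (card A)))"
proof -
  let ?L = "{x \<in> A. \<theta> x \<le> 1/2}" and ?H = "{x \<in> A. 1/2 < \<theta> x}"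
  have "(\<Sum>x\<in>?L. (1 - \<theta> x) * (d / \<theta> x)) \<le> (\<Sum>x\<in>?L. d / \<theta> x)"
    by (intro sum_mono mult_left_le_one_le) (use \<theta> d in \<open>auto simp: less_imp_le\<close>)
  also have "\<dots> \<le> 2 * Q"
    using bound[of "1/2"] by simp
  finally have low: "(\<Sum>x\<in>?L. (1 - \<theta> x) * (d / \<theta> x)) \<le> 2 * Q" .
  \<comment> \<open>For \<open>d > 0\<close> the value decreases in the threshold, so its rank
    counts the thresholds up to \<open>\<theta> x\<close>. Each of these contributes at least
    \<open>d\<close> to \<open>bound\<close> at \<open>\<beta> = \<theta> x\<close>. If
    \<open>d = 0\<close> or \<open>\<theta> x = 1\<close>, the value itself is 0.\<close>
  have rank: "(d * (1 - \<theta> x)) * real (card {y \<in> A. d * (1 - \<theta> x) \<le> d * (1 - \<theta> y)}) \<le> Q"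
    if x: "x \<in> A" for x
  proof (cases "d = 0 \<or> \<theta> x = 1")
    case True
    then show ?thesis using Q by auto
  next
    case False
    then have dpos: "0 < d" and lt: "\<theta> x < 1"
      using d \<theta>[OF x] by auto
    then have eq: "{y \<in> A. d * (1 - \<theta> x) \<le> d * (1 - \<theta> y)} = {y \<in> A. \<theta> y \<le> \<theta> x}"
      by auto
    have "d * real (card {y \<in> A. \<theta> y \<le> \<theta> x}) = (\<Sum>y\<in>{y \<in> A. \<theta> y \<le> \<theta> x}. d)"
      by simp
    also have "\<dots> \<le> (\<Sum>y\<in>{y \<in> A. \<theta> y \<le> \<theta> x}. d / \<theta> y)"
    proof (rule sum_mono)
      fix y assume "y \<in> {y \<in> A. \<theta> y \<le> \<theta> x}"
      then have "0 < \<theta> y" "\<theta> y \<le> 1" using \<theta> by auto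
      then show "d \<le> d / \<theta> y"
        using d by (simp add: le_divide_eq mult_left_le)
    qed
    finally have "(1 - \<theta> x) * (d * real (card {y \<in> A. \<theta> y \<le> \<theta> x})) \<le>
        (1 - \<theta> x) * (\<Sum>y\<in>{y \<in> A. \<theta> y \<le> \<theta> x}. d / \<theta> y)"
      using lt by (intro mult_left_mono) auto
    also have "\<dots> \<le> Q"
      using bound[of "\<theta> x"] \<theta>[OF x] lt by auto
    finally show ?thesis
      unfolding eq by (simp add: mult_ac)
  qed
  have "(\<Sum>x\<in>?H. (1 - \<theta> x) * (d / \<theta> x)) \<le> (\<Sum>x\<in>?H. 2 * (d * (1 - \<theta> x)))"
  proof (rule sum_mono)
    fix x assume "x \<in> ?H"
    then have *: "1/2 < \<theta> x" "\<theta> x \<le> 1" using \<theta> by auto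
    then have "d / \<theta> x \<le> 2 * d"
      using d mult_left_mono[of 1 "2 * \<theta> x" d] by (simp add: divide_le_eq mult_ac)
    then have "(1 - \<theta> x) * (d / \<theta> x) \<le> (1 - \<theta> x) * (2 * d)"
      using * by (intro mult_left_mono) auto
    then show "(1 - \<theta> x) * (d / \<theta> x) \<le> 2 * (d * (1 - \<theta> x))"
      by (simp add: mult_ac)
  qed
  also have "\<dots> \<le> (\<Sum>x\<in>A. 2 * (d * (1 - \<theta> x)))"
    by (rule sum_mono2) (use fin \<theta> d in auto)
  also have "\<dots> = 2 * (\<Sum>x\<in>A. d * (1 - \<theta> x))"
    by (simp add: sum_distrib_left)
  also have "\<dots> \<le> 2 * (Q * (1 + ln (real (card A))))"
    using sum_le_of_rank_bound[OF fin A Q, of "\<lambda>x. d * (1 - \<theta> x)"] rank by simp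
  finally have high: "(\<Sum>x\<in>?H. (1 - \<theta> x) * (d / \<theta> x)) \<le> 2 * (Q * (1 + ln (real (card A))))" .
  have card: "1 \<le> real (card A)"
    using fin A by (simp add: Suc_le_eq card_gt_0_iff)
  have "ln (real (card A)) \<le> log 2 (real (card A))"
  proof -
    have "ln 2 \<le> (1::real)"
      using ln_le_minus_one[of "2::real"] by simp
    then have "ln (real (card A)) * ln 2 \<le> ln (real (card A))"
      using card by (intro mult_left_le) auto
    then show ?thesis
      by (simp add: log_def le_divide_eq)
  qed
  then have "2 * (Q * (1 + ln (real (card A)))) \<le> 2 * (Q * (2 * max 1 (log 2 (real (card A)))))"
    using Q by (intro mult_left_mono) auto
  moreover have "2 * Q \<le> 2 * Q * max 1 (log 2 (real (card A)))"
    using Q by (simp add: mult_le_cancel_left1)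
  moreover have "(\<Sum>x\<in>A. (1 - \<theta> x) * (d / \<theta> x)) =
      (\<Sum>x\<in>?L. (1 - \<theta> x) * (d / \<theta> x)) + (\<Sum>x\<in>?H. (1 - \<theta> x) * (d / \<theta> x))"
    by (subst sum.union_disjoint[symmetric]) (use fin in \<open>auto intro!: sum.cong\<close>)
  ultimately show ?thesis
    using low high by linarith
qed

subsection \<open>The upper envelope of one type\<close>

text \<open>An action is read as the line with slope \<open>R i\<close> and intercept
  \<open>- c i\<close>; the maximal ones touch the upper envelope of all lines at
  \<open>\<alpha>\<close>.\<close>

definition maximal_at :: "nat set \<Rightarrow> (nat \<Rightarrow> real) \<Rightarrow> (nat \<Rightarrow> real) \<Rightarrow> real \<Rightarrow> nat \<Rightarrow> bool" where
  "maximal_at A c R \<alpha> i \<longleftrightarrow> i \<in> A \<and> (\<forall>j\<in>A. \<alpha> * R j - c j \<le> \<alpha> * R i - c i)"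

text \<open>The lead of line \<open>k\<close> over line \<open>j\<close> is affine. If
  \<open>k\<close> is at least as steep, its lead at \<open>a\<close> persists to the right;
  otherwise its lead at \<open>b\<close> persists to the left.\<close>

lemma maximal_at_between:
  assumes "maximal_at A c R a k" "maximal_at A c R b k" "a \<le> \<beta>" "\<beta> \<le> b"
  shows "maximal_at A c R \<beta> k"
  unfolding maximal_at_def
proof (intro conjI ballI)
  show "k \<in> A" using assms(1) by (simp add: maximal_at_def)
  fix j assume j: "j \<in> A"
  show "\<beta> * R j - c j \<le> \<beta> * R k - c k"
  proof (cases "R j \<le> R k")
    case True
    then have "(\<beta> - a) * R j \<le> (\<beta> - a) * R k"
      using assms(3) by (intro mult_left_mono) auto
    moreover have "a * R j - c j \<le> a * R k - c k"
      using assms(1) j by (simp add: maximal_at_def)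
    ultimately show ?thesis by (simp add: algebra_simps)
  next
    case False
    then have "(b - \<beta>) * R k \<le> (b - \<beta>) * R j"
      using assms(4) by (intro mult_left_mono) auto
    moreover have "b * R j - c j \<le> b * R k - c k"
      using assms(2) j by (simp add: maximal_at_def)
    ultimately show ?thesis by (simp add: algebra_simps)
  qed
qed

text \<open>Choosing the steepest maximal line matters twice: it stays on the envelope just to the
  right of \<open>\<alpha>\<close>, and it is the tie-break most profitable for the
  principal.\<close>

lemma ex_maximal_at:
  assumes "finite A" "A \<noteq> {}"
  obtains k where "maximal_at A c R \<alpha> k" "\<And>j. maximal_at A c R \<alpha> j \<Longrightarrow> R j \<le> R k"
proof -
  have fin: "finite {j. maximal_at A c R \<alpha> j}"
    by (rule finite_subset[OF _ assms(1)]) (auto simp: maximal_at_def)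
  obtain i where "is_arg_min (\<lambda>j. - (\<alpha> * R j - c j)) (\<lambda>j. j \<in> A) i"
    using ex_is_arg_min_if_finite[OF assms, of "\<lambda>j. - (\<alpha> * R j - c j)"] by blast
  then have "maximal_at A c R \<alpha> i"
    unfolding is_arg_min_linorder maximal_at_def by force
  then have ne: "{j. maximal_at A c R \<alpha> j} \<noteq> {}" by auto
  obtain k where "is_arg_min (\<lambda>j. - R j) (\<lambda>j. j \<in> {j. maximal_at A c R \<alpha> j}) k"
    using ex_is_arg_min_if_finite[OF fin ne] by blast
  then show ?thesis
    using that[of k] by (auto simp: is_arg_min_linorder)
qed

text \<open>Finds the next breakpoint of the envelope. The line \<open>k\<close>, steepest at
  \<open>\<alpha>\<close>, is left at the first point where a steeper line crosses it; some such
  crossing precedes 1 because \<open>k\<close> is beaten at 1.\<close>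

lemma ex_next_maximal_at:
  assumes fin: "finite A" and k: "maximal_at A c R \<alpha> k"
    and kmax: "\<And>j. maximal_at A c R \<alpha> j \<Longrightarrow> R j \<le> R k"
    and \<alpha>: "\<alpha> < 1" and not1: "\<not> maximal_at A c R 1 k"
  obtains \<alpha>' j where "\<alpha> < \<alpha>'" "\<alpha>' < 1" "maximal_at A c R \<alpha>' k" "maximal_at A c R \<alpha>' j" "R k < R j"
    "\<And>i. maximal_at A c R \<alpha>' i \<Longrightarrow> R i \<le> R j"
proof -
  have kA: "k \<in> A" using k by (simp add: maximal_at_def)
  have kle: "\<alpha> * R l - c l \<le> \<alpha> * R k - c k" if "l \<in> A" for l
    using k that by (simp add: maximal_at_def)
  define J where "J = {l \<in> A. R k < R l}"
  \<comment> \<open>The abscissa at which line \<open>l\<close> crosses line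
    \<open>k\<close>.\<close>
  define q where "q l = (c l - c k) / (R l - R k)" for l
  obtain p where p: "p \<in> A" "R k - c k < R p - c p"
    using not1 kA by (auto simp: maximal_at_def not_le)
  have "\<alpha> * R p - c p \<le> \<alpha> * R k - c k" by (rule kle[OF p(1)])
  then have "(1 - \<alpha>) * R k < (1 - \<alpha>) * R p"
    using p(2) by (simp add: algebra_simps)
  then have "R k < R p" using \<alpha> by simp
  then have pJ: "p \<in> J" using p by (simp add: J_def)
  have "finite J" using fin by (simp add: J_def)
  then obtain l where l: "l \<in> J" "\<And>i. i \<in> J \<Longrightarrow> q l \<le> q i"
    using pJ ex_is_arg_min_if_finite[of J q] by (auto simp: is_arg_min_linorder)
  \<comment> \<open>A steeper line crossing no later than \<open>\<alpha>\<close> would be maximal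
    at \<open>\<alpha>\<close>, against the choice of \<open>k\<close> as steepest there.\<close>
  have gt: "\<alpha> < q i" if "i \<in> J" for i
  proof (rule ccontr)
    assume "\<not> \<alpha> < q i"
    then have "c i - c k \<le> \<alpha> * (R i - R k)"
      using that by (simp add: q_def J_def not_less divide_le_eq)
    then have "\<alpha> * R k - c k \<le> \<alpha> * R i - c i"
      by (simp add: algebra_simps)
    then have "maximal_at A c R \<alpha> i"
      unfolding maximal_at_def using kle that by (auto simp: J_def intro: order_trans)
    then show False
      using kmax that by (force simp: J_def)
  qed
  have "q p < 1"
    using p(2) \<open>R k < R p\<close> by (simp add: q_def divide_less_eq)
  then have lt1: "q l < 1" using l(2)[OF pJ] by linarith
  have kql: "maximal_at A c R (q l) k"
    unfolding maximal_at_def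
  proof (intro conjI ballI)
    fix i assume i: "i \<in> A"
    show "q l * R i - c i \<le> q l * R k - c k"
    proof (cases "i \<in> J")
      case True
      then have "q l * (R i - R k) \<le> c i - c k"
        using l(2)[OF True] by (simp add: q_def[of i] J_def le_divide_eq)
      then show ?thesis by (simp add: algebra_simps)
    next
      case False
      then have "(q l - \<alpha>) * R i \<le> (q l - \<alpha>) * R k"
        using gt[OF l(1)] i by (intro mult_left_mono) (auto simp: J_def)
      then show ?thesis using kle[OF i] by (simp add: algebra_simps)
    qed
  qed (rule kA)
  have "q l * (R l - R k) = c l - c k"
    using l(1) by (simp add: q_def J_def)
  then have "q l * R l - c l = q l * R k - c k"
    by (simp add: algebra_simps)
  then have lql: "maximal_at A c R (q l) l"
    using kql l(1) by (auto simp: maximal_at_def J_def)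
  \<comment> \<open>Several lines may meet at the breakpoint; the steepest one restores the
    hypothesis on \<open>k\<close> for the next round.\<close>
  obtain j where j: "maximal_at A c R (q l) j" "\<And>i. maximal_at A c R (q l) i \<Longrightarrow> R i \<le> R j"
    using ex_maximal_at[of A c R "q l"] fin kA by blast
  have "R k < R j" using j(2)[OF lql] l(1) by (simp add: J_def)
  then show ?thesis
    using that[of "q l" j] gt[OF l(1)] lt1 kql j by blast
qed

text \<open>Follows the envelope from breakpoint to breakpoint, by induction on
  \<open>n - k\<close>. A jump from \<open>k\<close> to \<open>j\<close> passes all cost gaps in
  between, and these receive the breakpoint as their \<open>\<theta>\<close>.\<close>

lemma envelope_gaps_from:
  assumes mono: "mono_on {1..n} c" and \<alpha>: "0 \<le> \<alpha>" "\<alpha> < 1"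
    and k: "maximal_at {1..n} c R \<alpha> k"
    and kmax: "\<And>j. maximal_at {1..n} c R \<alpha> j \<Longrightarrow> R j \<le> R k"
  shows "\<exists>\<theta>::nat \<Rightarrow> real. (\<forall>i. \<alpha> < \<theta> i \<and> \<theta> i \<le> 1) \<and>
    (\<forall>\<beta>\<in>{\<alpha>..<1}. \<exists>i. maximal_at {1..n} c R \<beta> i \<and>
       R k + (\<Sum>i\<in>{i \<in> {k..<n}. \<theta> i \<le> \<beta>}. (c (i + 1) - c i) / \<theta> i) \<le> R i) \<and>
    (\<forall>i\<in>{1..n}. R i - c i \<le> R k - c k + (\<Sum>i\<in>{k..<n}. (1 - \<theta> i) * ((c (i + 1) - c i) / \<theta> i)))"
  using \<alpha> k kmax
proof (induction "n - k" arbitrary: k \<alpha> rule: less_induct)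
  case less
  show ?case
  proof (cases "maximal_at {1..n} c R 1 k")
    case True
    have max: "\<exists>i. maximal_at {1..n} c R \<beta> i \<and> R k \<le> R i" if "\<beta> \<in> {\<alpha>..<1}" for \<beta>
    proof -
      have "maximal_at {1..n} c R \<beta> k"
        by (rule maximal_at_between[OF less.prems(3) True]) (use that in auto)
      then show ?thesis by blast
    qed
    have empty: "{i \<in> {k..<n}. 1 \<le> \<beta>} = {}" if "\<beta> \<in> {\<alpha>..<1}" for \<beta> :: real
      using that by auto
    \<comment> \<open>No gap is passed before 1. The value \<open>\<theta> = 1\<close> keeps every
      gap out of the sums for \<open>\<beta> < 1\<close> and gives it weight
      \<open>1 - \<theta> = 0\<close> in the welfare bound.\<close>
    show ?thesis
      using max empty True less.prems(2)
      by (intro exI[of _ "\<lambda>_. 1"]) (auto simp: maximal_at_def)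
  next
    case False
    obtain \<alpha>' j where a: "\<alpha> < \<alpha>'" "\<alpha>' < 1" and k': "maximal_at {1..n} c R \<alpha>' k"
      and j: "maximal_at {1..n} c R \<alpha>' j" "R k < R j"
      "\<And>i. maximal_at {1..n} c R \<alpha>' i \<Longrightarrow> R i \<le> R j"
      by (rule ex_next_maximal_at[OF _ less.prems(3) _ less.prems(2) False])
        (use less.prems(4) in auto)
    have kn: "k \<in> {1..n}" and jn: "j \<in> {1..n}"
      using k' j(1) by (auto simp: maximal_at_def)
    have "\<alpha>' * R k - c k = \<alpha>' * R j - c j"
      using k' j(1) by (auto simp: maximal_at_def intro: antisym)
    \<comment> \<open>The two lines meet at \<open>\<alpha>'\<close>, so the reward rises by the
      cost difference divided by \<open>\<alpha>'\<close>. As \<open>\<alpha>' > 0\<close>, the cost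
      rises too, hence so does the index, which makes the induction terminate.\<close>
    then have step: "c j - c k = \<alpha>' * (R j - R k)"
      by (simp add: algebra_simps)
    have "0 < \<alpha>' * (R j - R k)"
      using a less.prems(1) j(2) by (intro mult_pos_pos) auto
    then have "c k < c j" using step by linarith
    then have kj: "k < j"
      using mono_onD[OF mono jn kn] by (meson not_less)
    obtain \<theta> :: "nat \<Rightarrow> real" where \<theta>: "\<And>i. \<alpha>' < \<theta> i" "\<And>i. \<theta> i \<le> 1"
      and up: "\<And>\<beta>. \<beta> \<in> {\<alpha>'..<1} \<Longrightarrow> \<exists>i. maximal_at {1..n} c R \<beta> i \<and>
         R j + (\<Sum>i\<in>{i \<in> {j..<n}. \<theta> i \<le> \<beta>}. (c (i + 1) - c i) / \<theta> i) \<le> R i"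
      and wf: "\<And>i. i \<in> {1..n} \<Longrightarrow>
        R i - c i \<le> R j - c j + (\<Sum>i\<in>{j..<n}. (1 - \<theta> i) * ((c (i + 1) - c i) / \<theta> i))"
    proof -
      have "n - j < n - k" using kj jn by auto
      from less.hyps[OF this _ a(2) j(1) j(3)] show ?thesis
        using that a(1) less.prems(1) by fastforce
    qed
    define \<theta>' where "\<theta>' i = (if i < j then \<alpha>' else \<theta> i)" for i
    have tele: "(\<Sum>i\<in>{k..<j}. (c (i + 1) - c i) / \<alpha>') = R j - R k"
    proof -
      have "(\<Sum>i\<in>{k..<j}. (c (i + 1) - c i) / \<alpha>') = (c j - c k) / \<alpha>'"
        using kj sum_Suc_diff'[of k j c] by (simp add: sum_divide_distrib[symmetric])
      then show ?thesis
        using step a less.prems(1) by simp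
    qed
    have split: "{k..<n} = {k..<j} \<union> {j..<n}"
      using kj jn by auto
    show ?thesis
    proof (intro exI[of _ \<theta>'] conjI allI ballI)
      fix i
      show "\<alpha> < \<theta>' i" "\<theta>' i \<le> 1"
        using a \<theta>(1)[of i] \<theta>(2)[of i] by (auto simp: \<theta>'_def)
    next
      fix \<beta> assume \<beta>: "\<beta> \<in> {\<alpha>..<1}"
      show "\<exists>i. maximal_at {1..n} c R \<beta> i \<and>
         R k + (\<Sum>i\<in>{i \<in> {k..<n}. \<theta>' i \<le> \<beta>}. (c (i + 1) - c i) / \<theta>' i) \<le> R i"
      proof (cases "\<beta> < \<alpha>'")
        case True
        have "\<alpha>' \<le> \<theta>' i" for i
          using \<theta>(1)[of i] by (auto simp: \<theta>'_def)
        then have empty: "{i \<in> {k..<n}. \<theta>' i \<le> \<beta>} = {}"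
          using True by (auto simp: not_le intro: less_le_trans)
        have "maximal_at {1..n} c R \<beta> k"
          by (rule maximal_at_between[OF less.prems(3) k']) (use True \<beta> in auto)
        then show ?thesis unfolding empty by auto
      next
        case False
        have "(\<Sum>i\<in>{i \<in> {k..<n}. \<theta>' i \<le> \<beta>}. (c (i + 1) - c i) / \<theta>' i) =
          (\<Sum>i\<in>{k..<j} \<union> {i \<in> {j..<n}. \<theta> i \<le> \<beta>}. (c (i + 1) - c i) / \<theta>' i)"
          by (rule sum.cong) (use False kj jn in \<open>auto simp: \<theta>'_def split: if_splits\<close>)
        also have "\<dots> = (\<Sum>i\<in>{k..<j}. (c (i + 1) - c i) / \<theta>' i) +
          (\<Sum>i\<in>{i \<in> {j..<n}. \<theta> i \<le> \<beta>}. (c (i + 1) - c i) / \<theta>' i)"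
          by (rule sum.union_disjoint) auto
        also have "\<dots> = (\<Sum>i\<in>{k..<j}. (c (i + 1) - c i) / \<alpha>') +
          (\<Sum>i\<in>{i \<in> {j..<n}. \<theta> i \<le> \<beta>}. (c (i + 1) - c i) / \<theta> i)"
          by (simp add: \<theta>'_def)
        finally show ?thesis
          using up[of \<beta>] False \<beta> tele by auto
      qed
    next
      fix i assume i: "i \<in> {1..n}"
      have "(\<Sum>i\<in>{k..<n}. (1 - \<theta>' i) * ((c (i + 1) - c i) / \<theta>' i)) =
          (\<Sum>i\<in>{k..<j}. (1 - \<theta>' i) * ((c (i + 1) - c i) / \<theta>' i)) +
          (\<Sum>i\<in>{j..<n}. (1 - \<theta>' i) * ((c (i + 1) - c i) / \<theta>' i))"
        unfolding split by (rule sum.union_disjoint) auto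
      also have "\<dots> = (\<Sum>i\<in>{k..<j}. (1 - \<alpha>') * ((c (i + 1) - c i) / \<alpha>')) +
          (\<Sum>i\<in>{j..<n}. (1 - \<theta> i) * ((c (i + 1) - c i) / \<theta> i))"
        by (simp add: \<theta>'_def)
      \<comment> \<open>By \<open>step\<close> this is exactly the increase from
        \<open>R k - c k\<close> to \<open>R j - c j\<close>.\<close>
      also have "(\<Sum>i\<in>{k..<j}. (1 - \<alpha>') * ((c (i + 1) - c i) / \<alpha>')) = (1 - \<alpha>') * (R j - R k)"
        by (simp only: sum_distrib_left[symmetric] tele)
      finally show "R i - c i \<le>
          R k - c k + (\<Sum>i\<in>{k..<n}. (1 - \<theta>' i) * ((c (i + 1) - c i) / \<theta>' i))"
        using wf[OF i] step by (simp add: algebra_simps)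
    qed
  qed
qed

text \<open>Starts the walk at \<open>\<alpha> = 0\<close>, with \<open>R0\<close> the reward of the
  steepest maximal action \<open>k\<close> there. At 0 only cost counts, so \<open>c k = 0\<close>;
  all gaps below \<open>k\<close> vanish and may be added to the sums.\<close>

lemma envelope_gaps:
  fixes c R :: "nat \<Rightarrow> real"
  assumes n: "1 \<le> n" and mono: "mono_on {1..n} c" and c1: "c 1 = 0"
    and R: "\<And>i. i \<in> {1..n} \<Longrightarrow> 0 \<le> R i"
  obtains R0 :: real and \<theta> :: "nat \<Rightarrow> real"
  where "0 \<le> R0" "\<And>i. 0 < \<theta> i" "\<And>i. \<theta> i \<le> 1"
    "\<And>\<beta>. 0 \<le> \<beta> \<Longrightarrow> \<beta> < 1 \<Longrightarrow> \<exists>i. maximal_at {1..n} c R \<beta> i \<and>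
       R0 + (\<Sum>i\<in>{i \<in> {1..<n}. \<theta> i \<le> \<beta>}. (c (i + 1) - c i) / \<theta> i) \<le> R i"
    "\<And>i. i \<in> {1..n} \<Longrightarrow>
       R i - c i \<le> R0 + (\<Sum>i\<in>{1..<n}. (1 - \<theta> i) * ((c (i + 1) - c i) / \<theta> i))"
proof -
  obtain k where k: "maximal_at {1..n} c R 0 k"
    "\<And>j. maximal_at {1..n} c R 0 j \<Longrightarrow> R j \<le> R k"
    using ex_maximal_at[of "{1..n}" c R 0] n by auto
  have kn: "k \<in> {1..n}" and "0 * R 1 - c 1 \<le> 0 * R k - c k"
    using k(1) n unfolding maximal_at_def by (blast, simp)
  then have "c k \<le> 0" using c1 by simp
  have flat: "c i = 0" if "1 \<le> i" "i \<le> k" for i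
  proof -
    have "c 1 \<le> c i" "c i \<le> c k"
      using that kn by (auto intro!: mono_onD[OF mono])
    then show ?thesis using c1 \<open>c k \<le> 0\<close> by linarith
  qed
  have gap0: "c (i + 1) - c i = 0" if "i \<in> {1..<n}" "i \<notin> {k..<n}" for i
    using flat[of i] flat[of "i + 1"] that by simp
  obtain \<theta> :: "nat \<Rightarrow> real" where \<theta>: "\<And>i. 0 < \<theta> i" "\<And>i. \<theta> i \<le> 1"
    and up: "\<And>\<beta>. \<beta> \<in> {0..<1} \<Longrightarrow> \<exists>i. maximal_at {1..n} c R \<beta> i \<and>
         R k + (\<Sum>i\<in>{i \<in> {k..<n}. \<theta> i \<le> \<beta>}. (c (i + 1) - c i) / \<theta> i) \<le> R i"
    and wf: "\<And>i. i \<in> {1..n} \<Longrightarrow>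
        R i - c i \<le> R k - c k + (\<Sum>i\<in>{k..<n}. (1 - \<theta> i) * ((c (i + 1) - c i) / \<theta> i))"
    using envelope_gaps_from[OF mono order_refl zero_less_one k] by blast
  have "(\<Sum>i\<in>{i \<in> {k..<n}. \<theta> i \<le> \<beta>}. (c (i + 1) - c i) / \<theta> i) =
      (\<Sum>i\<in>{i \<in> {1..<n}. \<theta> i \<le> \<beta>}. (c (i + 1) - c i) / \<theta> i)" for \<beta>
    by (rule sum.mono_neutral_left) (use kn gap0 in auto)
  moreover have "(\<Sum>i\<in>{k..<n}. (1 - \<theta> i) * ((c (i + 1) - c i) / \<theta> i)) =
      (\<Sum>i\<in>{1..<n}. (1 - \<theta> i) * ((c (i + 1) - c i) / \<theta> i))"
    by (rule sum.mono_neutral_left) (use kn gap0 in auto)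
  moreover have "c k = 0" using flat kn by auto
  ultimately show ?thesis
    using that[of "R k" \<theta>] R[OF kn] \<theta> up wf by auto
qed

subsection \<open>Linear contracts\<close>

lemma best_responses_linear:
  "best_responses n m c F t (\<lambda>j. \<alpha> * r j) =
     {i. maximal_at {1..n} (c t) (expected_reward m F r t) \<alpha> i}"
proof -
  have "(\<Sum>j=1..m. F t i j * (\<alpha> * r j)) = \<alpha> * expected_reward m F r t i" for i
    by (simp add: expected_reward_def sum_distrib_left mult_ac)
  then show ?thesis
    by (auto simp: best_responses_def maximal_at_def is_arg_max_linorder)
qed

text \<open>The last conclusion is the tie-breaking in favour of the principal. It keeps the factor
  \<open>1 - \<alpha>\<close> because at \<open>\<alpha> = 1\<close> all best responses yield profit
  0 and the chosen one need not have the largest reward.\<close>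

lemma profit_linear:
  assumes n: "1 \<le> n" and \<alpha>: "\<alpha> \<le> 1"
  obtains a where "maximal_at {1..n} (c t) (expected_reward m F r t) \<alpha> a"
    "profit n m c F r t (\<lambda>j. \<alpha> * r j) = (1 - \<alpha>) * expected_reward m F r t a"
    "\<And>i. maximal_at {1..n} (c t) (expected_reward m F r t) \<alpha> i \<Longrightarrow>
       (1 - \<alpha>) * expected_reward m F r t i \<le> (1 - \<alpha>) * expected_reward m F r t a"
proof -
  let ?R = "expected_reward m F r t"
  let ?M = "maximal_at {1..n} (c t) ?R \<alpha>"
  have lin: "(\<Sum>j=1..m. F t i j * (r j - \<alpha> * r j)) = (1 - \<alpha>) * ?R i" for i
    by (simp add: expected_reward_def sum_distrib_left algebra_simps)
  define a where "a = agent_action n m c F r t (\<lambda>j. \<alpha> * r j)"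
  have a: "a = arg_max (\<lambda>i. (1 - \<alpha>) * ?R i) ?M"
    unfolding a_def agent_action_def best_responses_linear arg_max_on_def lin mem_Collect_eq ..
  obtain k where k: "?M k" "\<And>j. ?M j \<Longrightarrow> ?R j \<le> ?R k"
    using ex_maximal_at[of "{1..n}" "c t" ?R \<alpha>] n by auto
  \<comment> \<open>\<open>arg_max\<close> is a choice operator, so a maximizer has to be exhibited
    before anything is known about \<open>a\<close>.\<close>
  have "is_arg_max (\<lambda>i. (1 - \<alpha>) * ?R i) ?M k"
    using k \<alpha> by (auto simp: is_arg_max_linorder intro: mult_left_mono)
  then have "is_arg_max (\<lambda>i. (1 - \<alpha>) * ?R i) ?M a"
    unfolding a arg_max_def by (rule someI)
  then show ?thesis
    using that[of a] unfolding is_arg_max_linorder profit_def lin a_def[symmetric] by blast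
qed

lemma expected_reward_nonneg:
  assumes "principal_agent n m T c F r" "t \<in> {1..T}" "i \<in> {1..n}"
  shows "0 \<le> expected_reward m F r t i"
  unfolding expected_reward_def
proof (rule sum_nonneg)
  fix j assume j: "j \<in> {1..m}"
  have "r 1 \<le> r j"
    using assms(1) j by (intro mono_onD[of "{1..m}" r]) (auto simp: principal_agent_def)
  moreover have "0 \<le> F t i j"
    using assms j unfolding principal_agent_def by blast
  ultimately show "0 \<le> F t i j * r j"
    using assms(1) by (simp add: principal_agent_def)
qed

text \<open>As \<open>opt_linear\<close> is a real supremum, it dominates its members once they are
  bounded above. The sum of all expected rewards of a type bounds its profit uniformly in the
  contract.\<close>

lemma profit_sum_le_opt_linear:
  assumes pa: "principal_agent n m T c F r" and \<alpha>: "0 \<le> \<alpha>" "\<alpha> \<le> 1"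
  shows "(\<Sum>t=1..T. profit n m c F r t (\<lambda>j. \<alpha> * r j)) \<le> real T * opt_linear n m T c F r"
proof -
  let ?p = "\<lambda>t \<alpha>. profit n m c F r t (\<lambda>j. \<alpha> * r j)"
  have n: "1 \<le> n" and T: "1 \<le> T" using pa by (auto simp: principal_agent_def)
  have le: "?p t \<beta> \<le> (\<Sum>i=1..n. expected_reward m F r t i)"
    if t: "t \<in> {1..T}" and \<beta>: "0 \<le> \<beta>" "\<beta> \<le> 1" for t \<beta>
  proof -
    obtain a where a: "a \<in> {1..n}" "?p t \<beta> = (1 - \<beta>) * expected_reward m F r t a"
      by (rule profit_linear[OF n \<beta>(2), of c t m F r]) (auto simp: maximal_at_def)
    have "?p t \<beta> \<le> expected_reward m F r t a"
      unfolding a(2) using expected_reward_nonneg[OF pa t a(1)] \<beta>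
      by (intro mult_left_le_one_le) auto
    also have "\<dots> \<le> (\<Sum>i=1..n. expected_reward m F r t i)"
      by (rule member_le_sum) (use a(1) expected_reward_nonneg[OF pa t] in auto)
    finally show ?thesis .
  qed
  have "bdd_above ((\<lambda>\<beta>. type_avg T (\<lambda>t. ?p t \<beta>)) ` {0..1})"
  proof (rule bdd_aboveI2)
    fix \<beta> :: real assume "\<beta> \<in> {0..1}"
    then show "type_avg T (\<lambda>t. ?p t \<beta>) \<le> type_avg T (\<lambda>t. \<Sum>i=1..n. expected_reward m F r t i)"
      unfolding type_avg_def by (intro divide_right_mono sum_mono le) auto
  qed
  then have "type_avg T (\<lambda>t. ?p t \<alpha>) \<le> opt_linear n m T c F r"
    unfolding opt_linear_def using \<alpha> by (intro cSUP_upper) auto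
  then show ?thesis
    using T by (simp add: type_avg_def divide_le_eq mult_ac)
qed

section \<open>Welfare against optimal linear profit\<close>

text \<open>With two actions there is a gap, and truncation makes each distinct value count at least
  1. This later absorbs the welfare already present at \<open>\<alpha> = 0\<close>.\<close>

lemma Delta_ge_1:
  assumes "1 \<le> T" "2 \<le> n"
  shows "1 \<le> Delta n T c"
proof -
  let ?S = "cost_differences n T c"
  have "(1, 1) \<in> {1..T} \<times> {1..<n}" using assms by auto
  then have "set_mset ?S \<noteq> {}"
    by (auto simp: cost_differences_def)
  then have "1 \<le> real (card (set_mset ?S))"
    by (simp add: Suc_le_eq card_gt_0_iff)
  also have "\<dots> = (\<Sum>d\<in>set_mset ?S. 1)" by simp
  also have "\<dots> \<le> Delta n T c"
    unfolding Delta_def by (rule sum_mono) simp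
  finally show ?thesis .
qed

text \<open>The summand 1 pays for the rewards \<open>R0\<close> obtained at
  \<open>\<alpha> = 0\<close>; the summand \<open>6 * Delta\<close> pays for the gaps, grouped by
  value over all types together.\<close>

lemma welfare_le_opt_linear:
  assumes pa: "principal_agent n m T c F r"
  shows "real T * welfare n m T c F r \<le>
    (1 + 6 * Delta n T c) * (real T * opt_linear n m T c F r)"
proof -
  let ?R = "expected_reward m F r"
  define Q where "Q = real T * opt_linear n m T c F r"
  define I where "I = {1..T} \<times> {1..<n}"
  define d where "d = (\<lambda>(t, i). c t (i + 1) - c t i)"
  have n: "1 \<le> n" and T: "1 \<le> T" using pa by (auto simp: principal_agent_def)
  have finI: "finite I" by (simp add: I_def)
  have dnn: "0 \<le> d x" if "x \<in> I" for x
  proof -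
    obtain t i where x: "x = (t, i)" "t \<in> {1..T}" "1 \<le> i" "i < n"
      using \<open>x \<in> I\<close> by (auto simp: I_def)
    have "mono_on {1..n} (c t)" using pa x(2) by (auto simp: principal_agent_def)
    from mono_onD[OF this, of i "i + 1"] have "c t i \<le> c t (i + 1)"
      using x(3,4) by simp
    then show ?thesis by (simp add: x(1) d_def)
  qed
  \<comment> \<open>Packs the conclusions of \<open>envelope_gaps\<close>, so that \<open>R0\<close>
    and \<open>\<theta>\<close> can be chosen for all types at once.\<close>
  define good where "good t R0 \<theta> \<longleftrightarrow> 0 \<le> R0 \<and> (\<forall>i. 0 < \<theta> i \<and> \<theta> i \<le> 1) \<and>
      (\<forall>\<beta>. 0 \<le> \<beta> \<longrightarrow> \<beta> < 1 \<longrightarrow> (\<exists>i. maximal_at {1..n} (c t) (?R t) \<beta> i \<and>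
         R0 + (\<Sum>i\<in>{i \<in> {1..<n}. \<theta> i \<le> \<beta>}. d (t, i) / \<theta> i) \<le> ?R t i)) \<and>
      (\<forall>i\<in>{1..n}. ?R t i - c t i \<le> R0 + (\<Sum>i\<in>{1..<n}. (1 - \<theta> i) * (d (t, i) / \<theta> i)))"
    for t and R0 :: real and \<theta> :: "nat \<Rightarrow> real"
  have "\<exists>R0 \<theta>. good t R0 \<theta>" if t: "t \<in> {1..T}" for t
  proof -
    have ct: "mono_on {1..n} (c t)" "c t 1 = 0"
      using pa t unfolding principal_agent_def by blast+
    show ?thesis
    proof (rule envelope_gaps[OF n ct expected_reward_nonneg[OF pa t]])
      fix R0 and \<theta> :: "nat \<Rightarrow> real"
      assume "0 \<le> R0" "\<And>i. 0 < \<theta> i" "\<And>i. \<theta> i \<le> 1"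
        "\<And>\<beta>. 0 \<le> \<beta> \<Longrightarrow> \<beta> < 1 \<Longrightarrow> \<exists>i. maximal_at {1..n} (c t) (?R t) \<beta> i \<and>
           R0 + (\<Sum>i\<in>{i \<in> {1..<n}. \<theta> i \<le> \<beta>}. (c t (i + 1) - c t i) / \<theta> i) \<le> ?R t i"
        "\<And>i. i \<in> {1..n} \<Longrightarrow>
           ?R t i - c t i \<le> R0 + (\<Sum>i\<in>{1..<n}. (1 - \<theta> i) * ((c t (i + 1) - c t i) / \<theta> i))"
      then have "good t R0 \<theta>"
        unfolding good_def d_def case_prod_conv by blast
      then show ?thesis by blast
    qed
  qed
  then obtain R0 :: "nat \<Rightarrow> real" and \<theta> :: "nat \<Rightarrow> nat \<Rightarrow> real"
    where good: "\<And>t. t \<in> {1..T} \<Longrightarrow> good t (R0 t) (\<theta> t)"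
    by metis
  define \<Theta> where "\<Theta> = (\<lambda>(t, i). \<theta> t i)"
  have \<Theta>: "0 < \<Theta> x" "\<Theta> x \<le> 1" if "x \<in> I" for x
    using that good by (auto simp: good_def I_def \<Theta>_def)
  have R0: "0 \<le> R0 t" if "t \<in> {1..T}" for t
    using good[OF that] by (simp add: good_def)

  have opt: "(1 - \<beta>) * ((\<Sum>t=1..T. R0 t) + (\<Sum>x\<in>{x \<in> I. \<Theta> x \<le> \<beta>}. d x / \<Theta> x)) \<le> Q"
    if \<beta>: "0 \<le> \<beta>" "\<beta> < 1" for \<beta>
  proof -
    let ?s = "\<lambda>t. R0 t + (\<Sum>i\<in>{i \<in> {1..<n}. \<theta> t i \<le> \<beta>}. d (t, i) / \<theta> t i)"
    have "{x \<in> I. \<Theta> x \<le> \<beta>} = Sigma {1..T} (\<lambda>t. {i \<in> {1..<n}. \<theta> t i \<le> \<beta>})"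
      by (auto simp: I_def \<Theta>_def)
    then have "(\<Sum>x\<in>{x \<in> I. \<Theta> x \<le> \<beta>}. d x / \<Theta> x) =
        (\<Sum>t=1..T. \<Sum>i\<in>{i \<in> {1..<n}. \<theta> t i \<le> \<beta>}. d (t, i) / \<theta> t i)"
      by (simp add: sum.Sigma \<Theta>_def split_def)
    then have "(1 - \<beta>) * ((\<Sum>t=1..T. R0 t) + (\<Sum>x\<in>{x \<in> I. \<Theta> x \<le> \<beta>}. d x / \<Theta> x)) =
        (\<Sum>t=1..T. (1 - \<beta>) * ?s t)"
      by (simp add: sum.distrib sum_distrib_left distrib_left)
    also have "\<dots> \<le> (\<Sum>t=1..T. profit n m c F r t (\<lambda>j. \<beta> * r j))"
    proof (rule sum_mono)
      fix t assume t: "t \<in> {1..T}"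
      obtain i where i: "maximal_at {1..n} (c t) (?R t) \<beta> i" "?s t \<le> ?R t i"
        using good[OF t] \<beta> by (auto simp: good_def)
      obtain a where a: "profit n m c F r t (\<lambda>j. \<beta> * r j) = (1 - \<beta>) * ?R t a"
        "\<And>i. maximal_at {1..n} (c t) (?R t) \<beta> i \<Longrightarrow> (1 - \<beta>) * ?R t i \<le> (1 - \<beta>) * ?R t a"
        by (rule profit_linear[OF n less_imp_le[OF \<beta>(2)], of c t m F r]) blast
      have "(1 - \<beta>) * ?s t \<le> (1 - \<beta>) * ?R t i"
        using i(2) \<beta> by (intro mult_left_mono) auto
      also have "\<dots> \<le> profit n m c F r t (\<lambda>j. \<beta> * r j)"
        unfolding a(1) by (rule a(2)[OF i(1)])
      finally show "(1 - \<beta>) * ?s t \<le> profit n m c F r t (\<lambda>j. \<beta> * r j)" .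
    qed
    also have "\<dots> \<le> Q"
      unfolding Q_def by (rule profit_sum_le_opt_linear[OF pa]) (use \<beta> in auto)
    finally show ?thesis .
  qed
  have "0 \<le> (\<Sum>t=1..T. R0 t)"
    using R0 by (intro sum_nonneg) auto
  \<comment> \<open>Thresholds are positive, so at \<open>\<beta> = 0\<close> the bound
    \<open>opt\<close> concerns the \<open>R0\<close> alone.\<close>
  moreover have "(\<Sum>x\<in>{x \<in> I. \<Theta> x \<le> 0}. d x / \<Theta> x) = 0"
    using \<Theta>(1) by (intro sum.neutral) force
  ultimately have base: "(\<Sum>t=1..T. R0 t) \<le> Q" "0 \<le> Q"
    using opt[of 0] by auto

  have S: "cost_differences n T c = image_mset d (mset_set I)"
    by (simp add: cost_differences_def d_def I_def)
  have setS: "set_mset (cost_differences n T c) = d ` I"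
    using finI by (simp add: S)
  have count: "count (cost_differences n T c) v = card {x \<in> I. d x = v}" for v
    unfolding S using finI
    by (simp add: count_image_mset vimage_def Int_def conj_commute)

  have group: "(\<Sum>x\<in>{x \<in> I. d x = v}. (1 - \<Theta> x) * (d x / \<Theta> x)) \<le>
      6 * Q * max 1 (log 2 (real (count (cost_differences n T c) v)))" if v: "v \<in> d ` I" for v
  proof -
    let ?A = "{x \<in> I. d x = v}"
    have bound: "(1 - \<beta>) * (\<Sum>x\<in>{x \<in> ?A. \<Theta> x \<le> \<beta>}. v / \<Theta> x) \<le> Q"
      if \<beta>: "0 \<le> \<beta>" "\<beta> < 1" for \<beta>
    proof -
      have "(\<Sum>x\<in>{x \<in> ?A. \<Theta> x \<le> \<beta>}. v / \<Theta> x) = (\<Sum>x\<in>{x \<in> ?A. \<Theta> x \<le> \<beta>}. d x / \<Theta> x)"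
        by (rule sum.cong) auto
      also have "\<dots> \<le> (\<Sum>x\<in>{x \<in> I. \<Theta> x \<le> \<beta>}. d x / \<Theta> x)"
        by (rule sum_mono2) (use finI dnn \<Theta>(1) in \<open>auto intro: divide_nonneg_pos\<close>)
      also have "\<dots> \<le> (\<Sum>t=1..T. R0 t) + (\<Sum>x\<in>{x \<in> I. \<Theta> x \<le> \<beta>}. d x / \<Theta> x)"
        using \<open>0 \<le> (\<Sum>t=1..T. R0 t)\<close> by simp
      finally have "(1 - \<beta>) * (\<Sum>x\<in>{x \<in> ?A. \<Theta> x \<le> \<beta>}. v / \<Theta> x) \<le>
          (1 - \<beta>) * ((\<Sum>t=1..T. R0 t) + (\<Sum>x\<in>{x \<in> I. \<Theta> x \<le> \<beta>}. d x / \<Theta> x))"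
        using \<beta> by (intro mult_left_mono) auto
      then show ?thesis using opt[OF \<beta>] by linarith
    qed
    have "(\<Sum>x\<in>?A. (1 - \<Theta> x) * (d x / \<Theta> x)) = (\<Sum>x\<in>?A. (1 - \<Theta> x) * (v / \<Theta> x))"
      by (rule sum.cong) auto
    also have "\<dots> \<le> 6 * Q * max 1 (log 2 (real (card ?A)))"
      by (rule sum_gaps_le) (use finI v dnn \<Theta> base(2) bound in auto)
    finally show ?thesis by (simp add: count)
  qed

  have "real T * welfare n m T c F r = (\<Sum>t=1..T. Max ((\<lambda>i. ?R t i - c t i) ` {1..n}))"
    using T by (simp add: welfare_def type_avg_def)
  also have "\<dots> \<le> (\<Sum>t=1..T. R0 t + (\<Sum>i\<in>{1..<n}. (1 - \<theta> t i) * (d (t, i) / \<theta> t i)))"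
  proof (rule sum_mono)
    fix t assume t: "t \<in> {1..T}"
    show "Max ((\<lambda>i. ?R t i - c t i) ` {1..n}) \<le>
        R0 t + (\<Sum>i\<in>{1..<n}. (1 - \<theta> t i) * (d (t, i) / \<theta> t i))"
      by (rule Max.boundedI) (use n good[OF t] in \<open>auto simp: good_def\<close>)
  qed
  also have "\<dots> = (\<Sum>t=1..T. R0 t) + (\<Sum>x\<in>I. (1 - \<Theta> x) * (d x / \<Theta> x))"
    by (simp add: sum.distrib I_def sum.Sigma \<Theta>_def split_def)
  also have "(\<Sum>x\<in>I. (1 - \<Theta> x) * (d x / \<Theta> x)) =
      (\<Sum>v\<in>d ` I. \<Sum>x\<in>{x \<in> I. d x = v}. (1 - \<Theta> x) * (d x / \<Theta> x))"
    using finI by (intro sum.image_gen)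
  also have "\<dots> \<le> (\<Sum>v\<in>d ` I. 6 * Q * max 1 (log 2 (real (count (cost_differences n T c) v))))"
    by (intro sum_mono group)
  also have "\<dots> = 6 * Q * Delta n T c"
    by (simp add: Delta_def setS sum_distrib_left)
  finally show ?thesis
    using base(1) unfolding Q_def[symmetric] by (simp add: algebra_simps)
qed

theorem corollary5:
  "\<exists>C::real. C > 0 \<and>
     (\<forall>(n::nat) (m::nat) (T::nat) (c::nat \<Rightarrow> nat \<Rightarrow> real) (F::nat \<Rightarrow> nat \<Rightarrow> nat \<Rightarrow> real) (r::nat \<Rightarrow> real).
        principal_agent n m T c F r \<longrightarrow>
        opt_linear n m T c F r \<ge> C * (1 / Delta n T c) * welfare n m T c F r)"
\<comment> \<open>The constant comes from \<open>1 + 6 * Delta \<le> 7 * Delta\<close>, valid once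
  \<open>Delta\<close> is at least 1.\<close>
proof (intro exI[of _ "1 / 7"] conjI allI impI)
  fix n m T c F r
  assume pa: "principal_agent n m T c F r"
  let ?opt = "opt_linear n m T c F r" and ?W = "welfare n m T c F r" and ?D = "Delta n T c"
  have n: "1 \<le> n" and T: "1 \<le> T" using pa by (auto simp: principal_agent_def)
  have "0 \<le> (\<Sum>t=1..T. profit n m c F r t (\<lambda>j. 0 * r j))"
  proof (rule sum_nonneg)
    fix t assume t: "t \<in> {1..T}"
    obtain a where "maximal_at {1..n} (c t) (expected_reward m F r t) 0 a"
      "profit n m c F r t (\<lambda>j. 0 * r j) = (1 - 0) * expected_reward m F r t a"
      by (rule profit_linear[OF n zero_le_one, of c t m F r]) blast
    then show "0 \<le> profit n m c F r t (\<lambda>j. 0 * r j)"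
      using expected_reward_nonneg[OF pa t] by (simp add: maximal_at_def)
  qed
  also have "\<dots> \<le> real T * ?opt"
    by (rule profit_sum_le_opt_linear[OF pa]) auto
  finally have opt: "0 \<le> ?opt"
    using T by (simp add: zero_le_mult_iff)
  show "1 / 7 * (1 / ?D) * ?W \<le> ?opt"
  proof (cases "n = 1")
    case True
    \<comment> \<open>A single action leaves no gaps; since \<open>1 / 0 = 0\<close>, the claim
      reduces to a nonnegative optimum.\<close>
    then have "?D = 0" by (simp add: Delta_def cost_differences_def)
    then show ?thesis using opt by simp
  next
    case False
    then have D: "1 \<le> ?D" using n T by (intro Delta_ge_1) auto
    have "real T * ?W \<le> real T * ((1 + 6 * ?D) * ?opt)"
      using welfare_le_opt_linear[OF pa] by (simp add: mult_ac)
    then have "?W \<le> (1 + 6 * ?D) * ?opt"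
      using T by simp
    also have "\<dots> \<le> (7 * ?D) * ?opt"
      using D opt by (intro mult_right_mono) auto
    finally show ?thesis
      using D by (simp add: divide_le_eq mult_ac)
  qed
qed simp

end
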